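(* Let $G=(V,E)$ be a word-representable graph whose connected components are $G_i=(V_i,E_i)$ for $i=1,\dots,k$. Then $$\ell(G)\le \sum_{i=1}^k\bigl(\ell(G_i)+|V_i|\bigr)-\max_{1\le j\le k}|V_j|.$$
   Context: All graphs are finite, simple and undirected. A graph $G=(V,E)$ is word-representable if there is a finite word $w$ over the alphabet $V$, containing every letter of $V$ at least once, such that for all distinct $x,y\in V$, $xy\in E$ if and only if $x$ and $y$ alternate in $w$ (i.e. the subword of $w$ consisting only of the occurrences of $x$ and $y$ has no two equal consecutive letters). Such a $w$ is said to word-represent $G$. For a word-representable graph $G$, $\ell(G)$ denotes the minimum length of a word that word-represents $G$. *)

theory Defs
  imports "Graph_Theory.Graph_Theory"
begin

text \<open>
  A finite simple undirected graph is a digraph satisfying the locale predicate \<^term>\<open>graph\<close>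
  of the Graph Theory library: finite, symmetric, without loops and without parallel arcs.
  Each undirected edge is thus a pair of opposite arcs, and adjacency is \<open>x \<rightarrow>\<^bsub>G\<^esub> y\<close>.
\<close>

definition alternate :: "'a \<Rightarrow> 'a \<Rightarrow> 'a list \<Rightarrow> bool" where
  "alternate x y w \<longleftrightarrow> distinct_adj (filter (\<lambda>z. z = x \<or> z = y) w)"

definition word_represents :: "'a list \<Rightarrow> ('a, 'b) pre_digraph \<Rightarrow> bool" where
  "word_represents w G \<longleftrightarrow>
     set w = verts G \<and>
     (\<forall>x \<in> verts G. \<forall>y \<in> verts G. x \<noteq> y \<longrightarrow> (x \<rightarrow>\<^bsub>G\<^esub> y \<longleftrightarrow> alternate x y w))"

definition word_representable :: "('a, 'b) pre_digraph \<Rightarrow> bool" where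
  "word_representable G \<longleftrightarrow> (\<exists>w. word_represents w G)"

text \<open>Meaningful for word-representable graphs only; otherwise \<^const>\<open>Least\<close> is unspecified.\<close>

definition min_word_length :: "('a, 'b) pre_digraph \<Rightarrow> nat" (\<open>\<ell>\<close>) where
  "\<ell> G = (LEAST n. \<exists>w. word_represents w G \<and> length w = n)"

text \<open>
  The connected components as graphs: maximal connected subgraphs. The library's
  \<^const>\<open>connected\<close> includes nonemptiness, so the null graph has no component.
\<close>

definition connected_components :: "('a, 'b) pre_digraph \<Rightarrow> ('a, 'b) pre_digraph set" where
  "connected_components G = {H. pre_digraph.max_subgraph G connected H}"

end

theory Submission
  imports Defs
begin

text \<open>
  Appending to a word \<open>v\<close> its letters in the order of their last occurrences changes no
  alternation inside \<open>v\<close>, and every letter of \<open>v\<close> then occurs at least twice. If the result is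
  placed after a word \<open>u\<close> over a disjoint alphabet, no letter of \<open>u\<close> alternates with a letter of
  \<open>v\<close>, as two copies of the latter become adjacent. So one starts with a shortest word of a largest
  component and attaches the other components in this way, at an extra cost of
  one letter per vertex.
\<close>

section \<open>Alternation in concatenated words\<close>

lemma alternate_commute: "alternate x y w \<longleftrightarrow> alternate y x w"
  by (simp add: alternate_def disj_commute)

lemma alternate_filter:
  assumes "x \<in> S" "y \<in> S"
  shows "alternate x y (filter (\<lambda>z. z \<in> S) w) \<longleftrightarrow> alternate x y w"
proof -
  have "filter (\<lambda>z. z = x \<or> z = y) (filter (\<lambda>z. z \<in> S) w) = filter (\<lambda>z. z = x \<or> z = y) w"
    using assms by (auto intro: filter_cong)
  then show ?thesis by (simp add: alternate_def)
qed

lemma alternate_append_disjoint: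
  assumes "x \<notin> set v" "y \<notin> set v"
  shows "alternate x y (u @ v) \<longleftrightarrow> alternate x y u"
    and "alternate x y (v @ u) \<longleftrightarrow> alternate x y u"
proof -
  have "filter (\<lambda>z. z = x \<or> z = y) v = []"
    using assms by (auto simp: filter_empty_conv)
  then show "alternate x y (u @ v) \<longleftrightarrow> alternate x y u"
    and "alternate x y (v @ u) \<longleftrightarrow> alternate x y u"
    by (simp_all add: alternate_def)
qed

lemma last_remdups: "last (remdups xs) = last xs"
  by (induction xs) auto

text \<open>\<open>remdups\<close> keeps last occurrences, so \<open>xs\<close> and
  \<open>remdups xs\<close> end with the same letter. With at least two letters present,
  \<open>remdups xs\<close> begins with a different one, so no repetition arises where the words
  meet. A single letter has to be excluded: for \<open>xs = [a]\<close> the result is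
  \<open>[a, a]\<close>.\<close>

lemma distinct_adj_append_remdups:
  assumes "card (set xs) \<noteq> 1"
  shows "distinct_adj (xs @ remdups xs) \<longleftrightarrow> distinct_adj xs"
proof (cases "xs = []")
  case False
  have "length (remdups xs) \<noteq> 1"
    using assms by (simp add: length_remdups_card_conv)
  then obtain a b ys where *: "remdups xs = a # b # ys"
    using False by (metis One_nat_def length_Cons list.size(3) neq_Nil_conv remdups_eq_nil_iff)
  have "distinct (a # b # ys)"
    by (metis * distinct_remdups)
  then have "hd (remdups xs) \<noteq> last (remdups xs)"
    unfolding * by (metis distinct.simps(2) last_ConsR last_in_set list.distinct(1) list.sel(1))
  moreover have "distinct_adj (remdups xs)"
    by (simp add: distinct_adj_altdef remdups_adj_distinct)
  ultimately show ?thesis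
    by (auto simp: distinct_adj_append_iff last_remdups)
qed simp

text \<open>Restricting a word to two letters commutes with \<open>remdups\<close>, so the previous
  lemma applies to the restriction of \<open>v\<close>, in which both letters occur.\<close>

lemma alternate_append_remdups:
  assumes "x \<in> set v" "y \<in> set v" "x \<noteq> y"
  shows "alternate x y (v @ remdups v) \<longleftrightarrow> alternate x y v"
proof -
  have "set (filter (\<lambda>z. z = x \<or> z = y) v) = {x, y}"
    using assms by auto
  then have "card (set (filter (\<lambda>z. z = x \<or> z = y) v)) \<noteq> 1"
    using \<open>x \<noteq> y\<close> by simp
  from distinct_adj_append_remdups[OF this] show ?thesis
    by (simp add: alternate_def remdups_filter)
qed

lemma not_alternate_append_repeat:
  assumes "x \<notin> set v" "y \<in> set v" "x \<notin> set v'" "y \<in> set v'"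
  shows "\<not> alternate x y (u @ v @ v')"
proof -
  define p where "p = (\<lambda>z. z = x \<or> z = y)"
  \<comment> \<open>Restricted to \<open>x\<close> and \<open>y\<close>, both \<open>v\<close> and
    \<open>v'\<close> are nonempty powers of \<open>y\<close>, so two copies of \<open>y\<close>
    become adjacent where they meet.\<close>
  have "set (filter p v) = {y}" "set (filter p v') = {y}"
    using assms by (auto simp: p_def)
  then have "filter p v \<noteq> []" "filter p v' \<noteq> []"
    "last (filter p v) \<in> {y}" "hd (filter p v') \<in> {y}"
    by (metis empty_iff insertI1 last_in_set list.set_sel(1) set_empty)+
  then have "\<not> distinct_adj (filter p (u @ v @ v'))"
    by (auto simp: distinct_adj_append_iff)
  then show ?thesis by (simp add: alternate_def p_def)
qed

text \<open>A pair inside one alphabet does not see the other word. For a mixed pair,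
  \<open>v\<close> and \<open>remdups v\<close> both contain the letter of \<open>v\<close> and lack
  the letter of \<open>u\<close>, which forces a repetition.\<close>

lemma alternate_join:
  assumes disj: "set u \<inter> set v = {}" and "x \<noteq> y"
    and x: "x \<in> set u \<union> set v" and y: "y \<in> set u \<union> set v"
  shows "alternate x y (u @ v @ remdups v) \<longleftrightarrow>
    x \<in> set u \<and> y \<in> set u \<and> alternate x y u \<or> x \<in> set v \<and> y \<in> set v \<and> alternate x y v"
proof -
  consider "x \<in> set u" "y \<in> set u" | "x \<in> set v" "y \<in> set v"
    | "x \<in> set u" "y \<in> set v" | "x \<in> set v" "y \<in> set u"
    using x y by auto
  then show ?thesis
  proof cases
    case 1
    then have "x \<notin> set v" "y \<notin> set v" using disj by auto
    with 1 show ?thesis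
      using alternate_append_disjoint(1)[of x "v @ remdups v" y u] by simp
  next
    case 2
    then have "x \<notin> set u" "y \<notin> set u" using disj by auto
    with 2 show ?thesis
      using alternate_append_disjoint(2)[of x u y "v @ remdups v"]
        alternate_append_remdups[of x v y] \<open>x \<noteq> y\<close> by simp
  next
    case 3
    then have "x \<notin> set v" "y \<notin> set u" using disj by auto
    with 3 show ?thesis
      using not_alternate_append_repeat[of x v y "remdups v" u] by simp
  next
    case 4
    then have "x \<notin> set u" "y \<notin> set v" using disj by auto
    with 4 show ?thesis
      using not_alternate_append_repeat[of y v x "remdups v" u]
      by (simp add: alternate_commute[of x y])
  qed
qed

text \<open>Induction on \<open>F\<close>: each new word \<open>w k\<close> is attached together
  with \<open>remdups (w k)\<close>. Only the starting word \<open>w j\<close> escapes the extra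
  cost, which is why \<open>j\<close> is kept apart from \<open>F\<close>.\<close>

lemma joined_word_exists:
  assumes "finite F" "j \<notin> F" "disjoint_family_on (\<lambda>i. set (w i)) (insert j F)"
  shows "\<exists>W. set W = (\<Union>i \<in> insert j F. set (w i)) \<and>
    length W = length (w j) + (\<Sum>i \<in> F. length (w i) + card (set (w i))) \<and>
    (\<forall>x \<in> set W. \<forall>y \<in> set W. x \<noteq> y \<longrightarrow>
      (alternate x y W \<longleftrightarrow>
        (\<exists>i \<in> insert j F. x \<in> set (w i) \<and> y \<in> set (w i) \<and> alternate x y (w i))))"
  using assms
proof (induction F rule: finite_induct)
  case empty
  show ?case by (rule exI[of _ "w j"]) simp
next
  case (insert k F)
  have "disjoint_family_on (\<lambda>i. set (w i)) (insert j F)"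
    using insert.prems(2) by (rule disjoint_family_on_mono[rotated]) auto
  then obtain W where W: "set W = (\<Union>i \<in> insert j F. set (w i))"
    "length W = length (w j) + (\<Sum>i \<in> F. length (w i) + card (set (w i)))"
    "\<And>x y. x \<in> set W \<Longrightarrow> y \<in> set W \<Longrightarrow> x \<noteq> y \<Longrightarrow> alternate x y W \<longleftrightarrow>
      (\<exists>i \<in> insert j F. x \<in> set (w i) \<and> y \<in> set (w i) \<and> alternate x y (w i))"
    using insert.IH insert.prems(1) by auto
  \<comment> \<open>Here \<open>i\<close> differs from \<open>k\<close>, since neither
    \<open>F\<close> nor \<open>j\<close> meets the new index.\<close>
  have "set (w i) \<inter> set (w k) = {}" if "i \<in> insert j F" for i
    using insert.prems insert.hyps that
    by (intro disjoint_family_onD[OF insert.prems(2)]) auto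
  then have disj: "set W \<inter> set (w k) = {}"
    unfolding W(1) by blast
  let ?W = "W @ w k @ remdups (w k)"
  have "alternate x y ?W \<longleftrightarrow> (\<exists>i \<in> insert j (insert k F).
      x \<in> set (w i) \<and> y \<in> set (w i) \<and> alternate x y (w i))"
    if xy: "x \<in> set ?W" "y \<in> set ?W" "x \<noteq> y" for x y
  proof -
    have "alternate x y ?W \<longleftrightarrow> x \<in> set W \<and> y \<in> set W \<and> alternate x y W \<or>
        x \<in> set (w k) \<and> y \<in> set (w k) \<and> alternate x y (w k)"
      using xy by (intro alternate_join[OF disj]) auto
    also have "x \<in> set W \<and> y \<in> set W \<and> alternate x y W \<longleftrightarrow>
        (\<exists>i \<in> insert j F. x \<in> set (w i) \<and> y \<in> set (w i) \<and> alternate x y (w i))"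
      using W(1) W(3)[of x y] \<open>x \<noteq> y\<close> by blast
    finally show ?thesis by blast
  qed
  moreover have "set ?W = (\<Union>i \<in> insert j (insert k F). set (w i))"
    using W(1) by auto
  \<comment> \<open>The appended \<open>remdups (w k)\<close> has one letter for each element of
    \<open>set (w k)\<close>.\<close>
  moreover have "length ?W = length (w j) + (\<Sum>i \<in> insert k F. length (w i) + card (set (w i)))"
    using W(2) insert.hyps by (simp add: length_remdups_card_conv)
  ultimately show ?case by blast
qed

section \<open>Shortest words and induced subgraphs\<close>

lemma min_word_length_le: "word_represents w G \<Longrightarrow> \<ell> G \<le> length w"
  unfolding min_word_length_def by (rule Least_le) blast

lemma obtain_shortest_word:
  assumes "word_representable G"
  obtains w where "word_represents w G" "length w = \<ell> G"
proof -
  have "\<exists>n w. word_represents w G \<and> length w = n"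
    using assms by (auto simp: word_representable_def)
  from LeastI_ex[OF this] show thesis
    unfolding min_word_length_def[symmetric] using that by blast
qed

lemma induced_subgraph_dominates_iff:
  assumes "induced_subgraph H G" "x \<in> verts H" "y \<in> verts H"
  shows "x \<rightarrow>\<^bsub>H\<^esub> y \<longleftrightarrow> x \<rightarrow>\<^bsub>G\<^esub> y"
proof -
  have "tail H = tail G" "head H = head G"
    and "arcs H = {e \<in> arcs G. tail G e \<in> verts H \<and> head G e \<in> verts H}"
    using assms(1) by (auto simp: induced_subgraph_def subgraph_def compatible_def)
  with assms(2,3) show ?thesis by (auto simp: arcs_ends_conv)
qed

text \<open>Deleting the letters outside \<open>verts H\<close> affects no alternation between the
  remaining ones. This gives each component a shortest word.\<close>

lemma word_representable_induced_subgraph: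
  assumes "word_representable G" "induced_subgraph H G"
  shows "word_representable H"
proof -
  obtain w where w: "word_represents w G"
    using assms(1) by (auto simp: word_representable_def)
  have sub: "verts H \<subseteq> verts G"
    using assms(2) by auto
  have "x \<rightarrow>\<^bsub>H\<^esub> y \<longleftrightarrow> alternate x y (filter (\<lambda>z. z \<in> verts H) w)"
    if "x \<in> verts H" "y \<in> verts H" "x \<noteq> y" for x y
    using w that sub
    by (auto simp: word_represents_def induced_subgraph_dominates_iff[OF assms(2)]
        alternate_filter)
  moreover have "set (filter (\<lambda>z. z \<in> verts H) w) = verts H"
    using w sub by (auto simp: word_represents_def)
  ultimately show ?thesis
    unfolding word_representable_def word_represents_def by blast
qed

section \<open>Connected components as strongly connected components\<close>

lemma arc_mono_connected: "arc_mono connected"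
  unfolding arc_mono_def
  by (metis spanning_def subgraphE wf_digraph.connected_spanning_imp_connected)

lemma (in wf_digraph) strongly_connected_imp_connected:
  "strongly_connected G \<Longrightarrow> connected G"
  by (intro connectedI reachable_mk_symmetricI) (auto simp: strongly_connected_def)

text \<open>An induced subgraph inherits symmetry, so its paths can be reversed. An arbitrary
  subgraph may contain an arc without its opposite, and then the implication can fail.\<close>

lemma (in sym_digraph) connected_induced_imp_strongly_connected:
  assumes "induced_subgraph H G" "connected H"
  shows "strongly_connected H"
proof -
  interpret H: sym_digraph H
    using assms(1) by (rule induced_graph_imp_graph)
  show ?thesis
    using H.sym_arcs assms(2) by (rule H.symmetric_connected_imp_strongly_connected)
qed

text \<open>This makes the library facts on \<open>sccs\<close> (disjointness, finiteness, union
  equal to the graph) available for the components.\<close>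

lemma (in sym_digraph) connected_components_eq_sccs: "connected_components G = sccs"
  unfolding connected_components_def sccs_altdef2
proof (intro Collect_cong iffI)
  fix H
  assume max: "max_subgraph connected H"
  \<comment> \<open>Adding arcs on the same vertices preserves connectedness, so a maximal connected
    subgraph already has every arc of \<open>G\<close> between its vertices.\<close>
  have ind: "induced_subgraph H G"
    using max arc_mono_connected by (rule induced_subgraphI_arc_mono)
  have sc: "strongly_connected H"
    using ind max_subgraph_prop[OF max] by (rule connected_induced_imp_strongly_connected)
  show "max_subgraph strongly_connected H"
  proof (rule max_subgraphI)
    fix K
    assume K: "H \<noteq> K" "subgraph H K" "subgraph K G"
    then have "\<not> connected K"
      using max unfolding max_subgraph_def by metis
    moreover have "wf_digraph K" using K by auto
    ultimately show "\<not> strongly_connected K"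
      using wf_digraph.strongly_connected_imp_connected by blast
  qed (use ind sc in auto)
next
  fix H
  assume max: "max_subgraph strongly_connected H"
  have sub: "subgraph H G" by (rule subgraphI_max_subgraph[OF max])
  have "wf_digraph H" using sub by auto
  show "max_subgraph connected H"
  proof (rule max_subgraphI)
    show "connected H"
      using \<open>wf_digraph H\<close> max_subgraph_prop[OF max]
      by (rule wf_digraph.strongly_connected_imp_connected)
  next
    fix K
    assume K: "H \<noteq> K" "subgraph H K" "subgraph K G"
    show "\<not> connected K"
    proof
      assume "connected K"
      \<comment> \<open>\<open>K\<close> itself may lack opposite arcs and so need not be strongly
        connected; the subgraph induced on its vertices is.\<close>
      let ?K = "G \<restriction> verts K"
      have ind: "induced_subgraph ?K G" using K by auto
      have "subgraph K ?K" using K(3) by (rule subgraph_induce_subgraphI2)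
      then have "connected ?K"
        using \<open>connected K\<close> arc_mono_connected unfolding arc_mono_def by fastforce
      with ind have "strongly_connected ?K"
        by (rule connected_induced_imp_strongly_connected)
      moreover have "subgraph H ?K"
        using K(2) \<open>subgraph K ?K\<close> by (rule subgraph_trans)
      ultimately have "H = ?K"
        using max induced_imp_subgraph[OF ind] unfolding max_subgraph_def by metis
      \<comment> \<open>\<open>K\<close> lies between \<open>H\<close> and \<open>?K\<close>, which
        coincide.\<close>
      then have "K = H"
        using K(2) \<open>subgraph K ?K\<close>
        by (auto simp: subgraph_def compatible_def intro!: pre_digraph.equality)
      with K(1) show False by simp
    qed
  qed (rule sub)
qed

text \<open>A symmetric digraph is the union of its strongly connected components, so every arc lies
  in one of them, with the same ends as in \<open>G\<close>.\<close>

lemma (in sym_digraph) dominates_iff_sccs: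
  "x \<rightarrow> y \<longleftrightarrow> (\<exists>H \<in> sccs. x \<rightarrow>\<^bsub>H\<^esub> y)"
proof -
  have "arcs_ends H = (\<lambda>e. (tail G e, head G e)) ` arcs H" if "H \<in> sccs" for H
    using that by (auto simp: sccs_def subgraph_def compatible_def arcs_ends_conv)
  moreover have "arcs G = (\<Union>H \<in> sccs. arcs H)"
    using arg_cong[OF graph_is_union_sccs, of arcs] by (simp add: Union_def)
  ultimately show ?thesis
    by (auto simp: arcs_ends_conv)
qed

lemma (in sym_digraph) verts_eq_UN_sccs: "verts G = (\<Union>H \<in> sccs. verts H)"
  using arg_cong[OF graph_is_union_sccs, of verts] by (simp add: Union_def)

lemma (in fin_digraph) finite_sccs: "finite sccs"
  using finite_sccs_verts inj_on_verts_sccs by (simp add: sccs_verts_conv finite_image_iff)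

section \<open>The bound for the whole graph\<close>

theorem theorem2:
  fixes G :: "('a, 'b) pre_digraph"
  assumes "graph G"
    and "verts G \<noteq> {}"
    and "word_representable G"
  shows "int (\<ell> G) \<le>
    (\<Sum>H \<in> connected_components G. int (\<ell> H) + int (card (verts H)))
      - int (MAX H \<in> connected_components G. card (verts H))"
proof -
  interpret graph G by fact
  have "\<exists>w. word_represents w H \<and> length w = \<ell> H" if "H \<in> sccs" for H
    using word_representable_induced_subgraph[OF assms(3) in_sccs_imp_induced[OF that]]
    by (metis obtain_shortest_word)
  then obtain w where w: "\<And>H. H \<in> sccs \<Longrightarrow> word_represents (w H) H"
    and len: "\<And>H. H \<in> sccs \<Longrightarrow> length (w H) = \<ell> H"
    by metis
  have set_w: "set (w H) = verts H" if "H \<in> sccs" for H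
    using w[OF that] by (simp add: word_represents_def)
  \<comment> \<open>A nonempty graph has a component, so the maximum is attained; \<open>J\<close>
    below is a component attaining it and supplies the word that is not extended.\<close>
  have "(MAX H \<in> sccs. card (verts H)) \<in> (\<lambda>H. card (verts H)) ` sccs"
    using exists_scc[OF assms(2)] finite_sccs by (intro Max_in) auto
  then obtain J where J: "J \<in> sccs" "(MAX H \<in> sccs. card (verts H)) = card (verts J)"
    by auto
  let ?F = "sccs - {J}"
  have ins: "insert J ?F = sccs" using J by auto
  have "disjoint_family_on (\<lambda>H. set (w H)) (insert J ?F)"
    unfolding ins disjoint_family_on_def using scc_disj set_w by simp
  from joined_word_exists[OF finite_Diff[OF finite_sccs] _ this] obtain W
    where W: "set W = (\<Union>H \<in> sccs. set (w H))"
      "length W = length (w J) + (\<Sum>H \<in> ?F. length (w H) + card (set (w H)))"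
      "\<And>x y. x \<in> set W \<Longrightarrow> y \<in> set W \<Longrightarrow> x \<noteq> y \<Longrightarrow> alternate x y W \<longleftrightarrow>
        (\<exists>H \<in> sccs. x \<in> set (w H) \<and> y \<in> set (w H) \<and> alternate x y (w H))"
    unfolding ins by blast
  have set_W: "set W = verts G"
    using W(1) set_w by (simp add: verts_eq_UN_sccs)
  have "x \<rightarrow>\<^bsub>G\<^esub> y \<longleftrightarrow> alternate x y W" if xy: "x \<in> verts G" "y \<in> verts G" "x \<noteq> y" for x y
  proof -
    have "x \<rightarrow>\<^bsub>H\<^esub> y \<longleftrightarrow> x \<in> set (w H) \<and> y \<in> set (w H) \<and> alternate x y (w H)"
      if "H \<in> sccs" for H
    proof -
      have "wf_digraph H" using in_sccs_imp_induced[OF that] by auto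
      \<comment> \<open>Arcs of \<open>H\<close> have both ends in \<open>H\<close>, so the
        membership conditions in the description of \<open>W\<close> come for free.\<close>
      then have "x \<in> verts H \<and> y \<in> verts H" if "x \<rightarrow>\<^bsub>H\<^esub> y"
        using that by (simp add: wf_digraph.adj_in_verts)
      then show ?thesis
        using w[OF that] \<open>x \<noteq> y\<close> unfolding word_represents_def by blast
    qed
    then show ?thesis
      using W(3)[of x y] xy by (simp add: set_W dominates_iff_sccs)
  qed
  then have "word_represents W G"
    by (simp add: word_represents_def set_W)
  then have "\<ell> G \<le> length W" by (rule min_word_length_le)
  also have "length W = \<ell> J + (\<Sum>H \<in> ?F. \<ell> H + card (verts H))"
    using W(2) J(1) len set_w by simp
  finally have "int (\<ell> G) \<le> int (\<ell> J) + (\<Sum>H \<in> ?F. int (\<ell> H) + int (card (verts H)))"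
    by (simp flip: of_nat_add of_nat_sum)
  \<comment> \<open>Splitting off the summand of \<open>J\<close> from the full sum leaves
    \<open>\<ell> J\<close> once \<open>card (verts J)\<close> is subtracted.\<close>
  also have "\<dots> = (\<Sum>H \<in> sccs. int (\<ell> H) + int (card (verts H))) - int (card (verts J))"
    using J(1) finite_sccs by (simp add: sum.remove[of sccs J])
  finally show ?thesis
    by (simp add: connected_components_eq_sccs J(2))
qed

end
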